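(* Let $n,d\in\mathbb{N}$ (positive integers) and $\mathcal{X}=[0,1]^n$. For even degree, $\mathcal{A}=\mathbb{R}[x_1,\dots,x_n]_{\leq 2d}$ on $\mathcal{X}$, we have $$\mathcal{C}_{n,2d}\ \geq\ \binom{n+2d}{n}-n\cdot\binom{n+d-1}{n},$$ and for odd degree, $\mathcal{A}=\mathbb{R}[x_1,\dots,x_n]_{\leq 2d+1}$ on $\mathcal{X}$, we have $$\mathcal{C}_{n,2d+1}\ \geq\ \binom{n+2d+1}{n}-n\cdot\binom{n+d}{n}.$$
   Context: A linear functional $L:\mathbb{R}[x_1,\dots,x_n]_{\leq D}\to\mathbb{R}$ is a moment functional on $\mathcal{X}$ if there is a positive Borel measure $\mu$ on $\mathcal{X}$, with all polynomials of degree at most $D$ integrable, such that $L(f)=\int_{\mathcal{X}}f\,d\mu$ for all $f\in\mathbb{R}[x_1,\dots,x_n]_{\leq D}$. The Carathéodory number of such an $L$ is the minimal $k\in\mathbb{N}_0$ such that $L=\sum_{i=1}^k c_i l_{x_i}$ with $c_i>0$, $x_i\in\mathcal{X}$, where $l_x(f)=f(x)$ (such a $k$ always exists by Richter's theorem). $\mathcal{C}_{n,D}$ denotes the maximum of the Carathéodory numbers over all moment functionals $L:\mathbb{R}[x_1,\dots,x_n]_{\leq D}\to\mathbb{R}$ on $\mathcal{X}$. *)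

theory Defs
  imports "HOL-Analysis.Analysis" "HOL-Library.Poly_Mapping"
begin

text \<open>Formal polynomials over the reals in the variables \<open>x\<^sub>i\<close>, \<open>i :: 'n\<close>: finitely supported
  coefficient families, indexed by exponent vectors. The number of variables is \<open>CARD('n)\<close>.\<close>

type_synonym 'n mpoly = "('n \<Rightarrow>\<^sub>0 nat) \<Rightarrow>\<^sub>0 real"

definition mpoly_eval :: "'n::finite mpoly \<Rightarrow> real ^ 'n \<Rightarrow> real" where
  "mpoly_eval p x =
     (\<Sum>\<alpha>\<in>Poly_Mapping.keys p. Poly_Mapping.lookup p \<alpha> * (\<Prod>i\<in>UNIV. (x $ i) ^ Poly_Mapping.lookup \<alpha> i))"

definition mpolys_upto :: "nat \<Rightarrow> 'n::finite mpoly set" where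
  "mpolys_upto D = {p. \<forall>\<alpha>\<in>Poly_Mapping.keys p. (\<Sum>i\<in>UNIV. Poly_Mapping.lookup \<alpha> i) \<le> D}"

text \<open>A functional on \<open>mpolys_upto D\<close> is a function on all polynomials whose values outside
  \<open>mpolys_upto D\<close> are irrelevant: none of the notions below depends on them. The product
  \<open>Poly_Mapping.single 0 a * p\<close> is the scalar multiple of \<open>p\<close> by \<open>a\<close>.\<close>

definition linear_functional_upto :: "nat \<Rightarrow> ('n::finite mpoly \<Rightarrow> real) \<Rightarrow> bool" where
  "linear_functional_upto D L \<longleftrightarrow>
     (\<forall>p\<in>mpolys_upto D. \<forall>q\<in>mpolys_upto D. L (p + q) = L p + L q) \<and>
     (\<forall>a. \<forall>p\<in>mpolys_upto D. L (Poly_Mapping.single 0 a * p) = a * L p)"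

definition moment_functional :: "(real ^ 'n::finite) set \<Rightarrow> nat \<Rightarrow> ('n mpoly \<Rightarrow> real) \<Rightarrow> bool" where
  "moment_functional X D L \<longleftrightarrow>
     linear_functional_upto D L \<and>
     (\<exists>\<mu>. sets \<mu> = sets (restrict_space borel X) \<and>
        (\<forall>f\<in>mpolys_upto D. integrable \<mu> (mpoly_eval f) \<and> L f = (\<integral>x. mpoly_eval f x \<partial>\<mu>)))"

definition has_atomic_rep :: "(real ^ 'n::finite) set \<Rightarrow> nat \<Rightarrow> ('n mpoly \<Rightarrow> real) \<Rightarrow> nat \<Rightarrow> bool" where
  "has_atomic_rep X D L k \<longleftrightarrow>
     (\<exists>(c :: nat \<Rightarrow> real) (x :: nat \<Rightarrow> real ^ 'n).
        (\<forall>i<k. c i > 0 \<and> x i \<in> X) \<and>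
        (\<forall>f\<in>mpolys_upto D. L f = (\<Sum>i<k. c i * mpoly_eval f (x i))))"

text \<open>By Richter's theorem every moment functional has an atomic representation, so the least
  \<open>k\<close> below exists for the functionals to which it is applied.\<close>

definition caratheodory_number :: "(real ^ 'n::finite) set \<Rightarrow> nat \<Rightarrow> ('n mpoly \<Rightarrow> real) \<Rightarrow> nat" where
  "caratheodory_number X D L = (LEAST k. has_atomic_rep X D L k)"

text \<open>The maximum exists: the zero functional is a moment functional, and a minimal atomic
  representation has linearly independent point evaluations on \<open>mpolys_upto D\<close>, hence at most
  \<open>(CARD('n) + D) choose CARD('n)\<close> atoms.\<close>

definition max_caratheodory_number :: "(real ^ 'n::finite) set \<Rightarrow> nat \<Rightarrow> nat" where
  "max_caratheodory_number X D = Max {caratheodory_number X D L |L. moment_functional X D L}"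

definition unit_cube :: "(real ^ 'n::finite) set" where
  "unit_cube = {x. \<forall>i. x $ i \<in> {0..1}}"

end

theory Submission
  imports Defs "HOL-Computational_Algebra.Polynomial"
begin

text \<open>
  Put \<open>n = CARD('n)\<close>, let \<open>D\<close> be \<open>2d\<close> or \<open>2d + 1\<close>, and let \<open>Z\<close> be the \<open>d + 1\<close> nodes \<open>j/d\<close>,
  \<open>0 \<le> j \<le> d\<close>. There is a univariate polynomial \<open>q\<close> of degree at most \<open>D\<close> that is nonnegative on
  \<open>[0,1]\<close> and vanishes exactly on \<open>Z\<close>: interior nodes have to be double zeros, but a simple zero is
  enough at an endpoint of the interval. This is why the cube admits a finer grid than \<open>\<real>\<^sup>n\<close> does. The
  polynomial \<open>q(x\<^sub>1) + \<dots> + q(x\<^sub>n)\<close> has degree at most \<open>D\<close>, is nonnegative on the cube and vanishes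
  there exactly on the grid \<open>Z\<^sup>n\<close>. So a functional that is a positive combination of evaluations
  at grid points annihilates it, and all atoms of any other representation lie on the grid as well
  (\<open>atoms_in_zero_set\<close>).

  On the grid, the monomials whose exponents are all at most \<open>d\<close> are linearly independent
  (\<open>polynomial_nonzero_on_grid\<close>). Let \<open>M\<close> be the number of those of degree at most \<open>D\<close>. For every
  set \<open>S\<close> of fewer than \<open>M\<close> grid points, linear algebra gives a polynomial spanned by these monomials
  that vanishes on \<open>S\<close> but not on the whole grid. A functional with atoms in \<open>S\<close> annihilates it, whereas a
  combination of all grid evaluations with generic positive weights does not. As there are only
  finitely many sets \<open>S\<close>, one choice of weights serves them all (\<open>generic_positive_weights\<close>), and the
  resulting functional has Caratheodory number at least \<open>M\<close>.

  Finally, an exponent vector of degree at most \<open>D\<close> that is not counted by \<open>M\<close> has some coordinate at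
  least \<open>d + 1\<close>. Subtracting \<open>d + 1\<close> there leaves an exponent vector of degree at most \<open>D - d - 1\<close>,
  so at most \<open>n\<close> times \<open>(n + D - d - 1) choose n\<close> vectors are lost (\<open>card_bounded_exponents_ge\<close>).

  This number is a lower bound for the maximum because the maximum is taken over a finite set
  (\<open>finite_caratheodory_numbers\<close>), by Caratheodory's reduction (\<open>atomic_rep_reduce\<close>).
\<close>

section \<open>Homogeneous linear systems\<close>

text \<open>Gaussian elimination: one equation either is trivial or expresses one unknown through the
  others, so that eliminating it removes an equation and an unknown at once.\<close>

lemma underdetermined_system_nontrivial_solution:
  fixes f :: "'a \<Rightarrow> 'b \<Rightarrow> real"
  assumes "finite B" "finite A" "card B < card A"
  shows "\<exists>u. (\<exists>a\<in>A. u a \<noteq> 0) \<and> (\<forall>b\<in>B. (\<Sum>a\<in>A. u a * f a b) = 0)"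
  using assms
proof (induction B arbitrary: A f rule: finite_induct)
  case empty
  then have "A \<noteq> {}" by auto
  then show ?case by (intro exI[of _ "\<lambda>_. 1"]) auto
next
  case (insert b B)
  show ?case
  proof (cases "\<forall>a\<in>A. f a b = 0")
    case True
    have "card B < card A" using insert by simp
    then obtain u where "\<exists>a\<in>A. u a \<noteq> 0" "\<forall>b\<in>B. (\<Sum>a\<in>A. u a * f a b) = 0"
      using insert.IH[OF insert.prems(1)] by blast
    then show ?thesis using True by (intro exI[of _ u]) auto
  next
    case False
    then obtain a0 where a0: "a0 \<in> A" "f a0 b \<noteq> 0" by blast
    define A' where "A' = A - {a0}"
    define g where "g = (\<lambda>a c. f a c - f a b / f a0 b * f a0 c)"
    have fin: "finite A'" and "card B < card A'" and a0': "a0 \<notin> A'"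
      using insert a0 by (auto simp: A'_def)
    then obtain u where u: "\<exists>a\<in>A'. u a \<noteq> 0" "\<And>c. c \<in> B \<Longrightarrow> (\<Sum>a\<in>A'. u a * g a c) = 0"
      using insert.IH[OF fin, of g] by blast
    define v where "v = u(a0 := - (\<Sum>a\<in>A'. u a * f a b) / f a0 b)"
    have A: "A = insert a0 A'" using a0 by (auto simp: A'_def)
    have v_sum: "(\<Sum>a\<in>A. v a * f a c) = v a0 * f a0 c + (\<Sum>a\<in>A'. u a * f a c)" for c
      unfolding A using fin a0'
      by (simp, intro sum.cong) (auto simp: v_def)
    have "(\<Sum>a\<in>A. v a * f a c) = 0" if "c \<in> insert b B" for c
    proof (cases "c = b")
      case True
      show ?thesis unfolding v_sum True using a0 by (simp add: v_def)
    next
      case False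
      have "(\<Sum>a\<in>A'. u a * g a c)
            = (\<Sum>a\<in>A'. u a * f a c) - (\<Sum>a\<in>A'. u a * f a b) / f a0 b * f a0 c"
        by (simp add: g_def algebra_simps sum_subtractf sum_distrib_left sum_divide_distrib)
      then show ?thesis using u(2)[of c] that False unfolding v_sum by (simp add: v_def)
    qed
    moreover have "\<exists>a\<in>A. v a \<noteq> 0"
      using u(1) a0' by (auto simp: A v_def)
    ultimately show ?thesis by blast
  qed
qed

section \<open>Polynomials and their coefficients\<close>

definition total_degree :: "('n::finite \<Rightarrow>\<^sub>0 nat) \<Rightarrow> nat" where
  "total_degree \<alpha> = (\<Sum>i\<in>UNIV. Poly_Mapping.lookup \<alpha> i)"

definition monomial_eval :: "('n::finite \<Rightarrow>\<^sub>0 nat) \<Rightarrow> real ^ 'n \<Rightarrow> real" where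
  "monomial_eval \<alpha> x = (\<Prod>i\<in>UNIV. (x $ i) ^ Poly_Mapping.lookup \<alpha> i)"

definition mpoly_of :: "('n::finite \<Rightarrow>\<^sub>0 nat) set \<Rightarrow> (('n \<Rightarrow>\<^sub>0 nat) \<Rightarrow> real) \<Rightarrow> 'n mpoly" where
  "mpoly_of A u = (\<Sum>\<alpha>\<in>A. Poly_Mapping.single \<alpha> (u \<alpha>))"

lemma mpoly_eval_superset:
  assumes "finite K" "Poly_Mapping.keys p \<subseteq> K"
  shows "mpoly_eval p x = (\<Sum>\<alpha>\<in>K. Poly_Mapping.lookup p \<alpha> * monomial_eval \<alpha> x)"
  unfolding mpoly_eval_def monomial_eval_def
  using assms by (intro sum.mono_neutral_left) (auto simp: in_keys_iff)

lemma mpoly_eval_add: "mpoly_eval (p + q) x = mpoly_eval p x + mpoly_eval q x"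
proof -
  let ?K = "Poly_Mapping.keys p \<union> Poly_Mapping.keys q"
  have "finite ?K" "Poly_Mapping.keys (p + q) \<subseteq> ?K" using keys_add[of p q] by auto
  then show ?thesis
    by (simp add: mpoly_eval_superset[of ?K] lookup_add algebra_simps sum.distrib)
qed

lemma mpoly_eval_zero: "mpoly_eval 0 x = 0"
  by (simp add: mpoly_eval_def)

lemma mpoly_eval_sum: "mpoly_eval (sum p A) x = (\<Sum>a\<in>A. mpoly_eval (p a) x)"
  by (induction A rule: infinite_finite_induct) (auto simp: mpoly_eval_add mpoly_eval_zero)

lemma mpoly_eval_single: "mpoly_eval (Poly_Mapping.single \<alpha> a) x = a * monomial_eval \<alpha> x"
  by (simp add: mpoly_eval_superset[of "{\<alpha>}"])

lemma mpoly_eval_scale: "mpoly_eval (Poly_Mapping.single 0 a * p) x = a * mpoly_eval p x"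
proof -
  have lookup: "Poly_Mapping.lookup (Poly_Mapping.single 0 a * p) \<alpha> = a * Poly_Mapping.lookup p \<alpha>" for \<alpha>
    unfolding mult_map_scale_conv_mult[symmetric]
    by (simp add: Poly_Mapping.map.rep_eq when_def)
  then have "Poly_Mapping.keys (Poly_Mapping.single 0 a * p) \<subseteq> Poly_Mapping.keys p"
    by (auto simp: in_keys_iff)
  then show ?thesis
    by (simp add: mpoly_eval_superset[of "Poly_Mapping.keys p"] lookup sum_distrib_left mult.assoc)
qed

lemma mpoly_eval_mpoly_of: "mpoly_eval (mpoly_of A u) x = (\<Sum>\<alpha>\<in>A. u \<alpha> * monomial_eval \<alpha> x)"
  by (simp add: mpoly_of_def mpoly_eval_sum mpoly_eval_single)

lemma mpolys_upto_iff: "p \<in> mpolys_upto D \<longleftrightarrow> Poly_Mapping.keys p \<subseteq> {\<alpha>. total_degree \<alpha> \<le> D}"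
  by (auto simp: mpolys_upto_def total_degree_def)

lemma mpoly_of_in_mpolys_upto:
  assumes "A \<subseteq> {\<alpha>. total_degree \<alpha> \<le> D}"
  shows "mpoly_of A u \<in> mpolys_upto D"
proof -
  have "Poly_Mapping.keys (mpoly_of A u) \<subseteq> A"
    unfolding mpoly_of_def by (rule order_trans[OF keys_sum]) auto
  then show ?thesis using assms unfolding mpolys_upto_iff by blast
qed

lemma continuous_on_mpoly_eval: "continuous_on S (mpoly_eval p)"
  unfolding mpoly_eval_def by (intro continuous_intros)

section \<open>Counting exponent vectors\<close>

lemma total_degree_add: "total_degree (\<alpha> + \<beta>) = total_degree \<alpha> + total_degree \<beta>"
  by (simp add: total_degree_def lookup_add sum.distrib)

lemma total_degree_single: "total_degree (Poly_Mapping.single i k) = k"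
  by (simp add: total_degree_def lookup_single when_def)

text \<open>Subtraction of exponents is truncated, hence the condition.\<close>

lemma shift_exponent:
  assumes "k \<le> Poly_Mapping.lookup \<alpha> i"
  shows "\<alpha> = (\<alpha> - Poly_Mapping.single i k) + Poly_Mapping.single i (k :: nat)"
  using assms by (intro poly_mapping_eqI) (auto simp: lookup_add lookup_minus lookup_single when_def)

lemma total_degree_eq_0_iff: "total_degree \<alpha> = 0 \<longleftrightarrow> \<alpha> = 0"
  by (auto simp: total_degree_def intro!: poly_mapping_eqI)

text \<open>Pascal's recursion: an exponent vector supported on \<open>I\<close> with one further index \<open>i\<close> either does
  not involve \<open>i\<close>, or arises by raising the exponent of \<open>i\<close> in a vector of smaller degree. The
  supports \<open>I\<close> replace an induction on the number of variables, which is fixed by the type.\<close>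

lemma card_exponents_supported:
  fixes I :: "'n::finite set"
  shows "finite {\<alpha>. Poly_Mapping.keys \<alpha> \<subseteq> I \<and> total_degree \<alpha> \<le> D} \<and>
         card {\<alpha>. Poly_Mapping.keys \<alpha> \<subseteq> I \<and> total_degree \<alpha> \<le> D} = (card I + D) choose card I"
proof (induction I arbitrary: D rule: finite_induct[OF finite])
  case 1
  have "{\<alpha> :: 'n \<Rightarrow>\<^sub>0 nat. Poly_Mapping.keys \<alpha> \<subseteq> {} \<and> total_degree \<alpha> \<le> D} = {0}" for D
    by (auto simp: total_degree_def)
  then show ?case by simp
next
  case (2 i I)
  let ?E = "\<lambda>I D. {\<alpha>. Poly_Mapping.keys \<alpha> \<subseteq> I \<and> total_degree \<alpha> \<le> D}"
  let ?shift = "\<lambda>\<alpha>. \<alpha> + Poly_Mapping.single i (1::nat)"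
  show ?case
  proof (induction D)
    case 0
    have "?E (insert i I) 0 = {0}" by (auto simp: total_degree_eq_0_iff)
    then show ?case by simp
  next
    case (Suc D)
    have split: "?E (insert i I) (Suc D) = ?E I (Suc D) \<union> ?shift ` ?E (insert i I) D"
    proof (intro equalityI subsetI)
      fix \<alpha> assume \<alpha>: "\<alpha> \<in> ?E (insert i I) (Suc D)"
      show "\<alpha> \<in> ?E I (Suc D) \<union> ?shift ` ?E (insert i I) D"
      proof (cases "i \<in> Poly_Mapping.keys \<alpha>")
        case False
        then show ?thesis using \<alpha> by auto
      next
        case True
        define \<beta> where "\<beta> = \<alpha> - Poly_Mapping.single i 1"
        have eq: "\<alpha> = ?shift \<beta>"
          unfolding \<beta>_def using True by (intro shift_exponent) (auto simp: in_keys_iff)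
        have "Poly_Mapping.keys \<beta> \<subseteq> Poly_Mapping.keys \<alpha>"
          by (auto simp: \<beta>_def in_keys_iff lookup_minus)
        moreover have "total_degree \<alpha> = Suc (total_degree \<beta>)"
          by (subst eq) (simp add: total_degree_add total_degree_single)
        ultimately have "\<beta> \<in> ?E (insert i I) D" using \<alpha> by auto
        then show ?thesis using eq by blast
      qed
    next
      fix \<alpha> assume "\<alpha> \<in> ?E I (Suc D) \<union> ?shift ` ?E (insert i I) D"
      then show "\<alpha> \<in> ?E (insert i I) (Suc D)"
      proof
        assume "\<alpha> \<in> ?shift ` ?E (insert i I) D"
        then obtain \<beta> where "\<alpha> = ?shift \<beta>" "\<beta> \<in> ?E (insert i I) D" by blast
        then show ?thesis
          using keys_add[of \<beta> "Poly_Mapping.single i 1"]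
          by (auto simp: total_degree_add total_degree_single split: if_splits)
      qed auto
    qed
    have disj: "?E I (Suc D) \<inter> ?shift ` ?E (insert i I) D = {}"
      using \<open>i \<notin> I\<close> by (force simp: in_keys_iff lookup_add subset_iff)
    have "inj_on ?shift (?E (insert i I) D)" by (auto intro: inj_onI)
    then have "card (?E (insert i I) (Suc D))
        = ((card I + Suc D) choose card I) + ((card (insert i I) + D) choose card (insert i I))"
      unfolding split using 2 Suc disj by (simp add: card_Un_disjoint card_image)
    also have "\<dots> = (card (insert i I) + Suc D) choose card (insert i I)"
      using 2 by simp
    finally show ?case unfolding split using 2 Suc by simp
  qed
qed

lemma finite_exponents: "finite {\<alpha> :: 'n::finite \<Rightarrow>\<^sub>0 nat. total_degree \<alpha> \<le> D}"
  using card_exponents_supported[of "UNIV :: 'n set" D] by simp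

lemma card_exponents:
  "card {\<alpha> :: 'n::finite \<Rightarrow>\<^sub>0 nat. total_degree \<alpha> \<le> D} = (CARD('n) + D) choose CARD('n)"
  using card_exponents_supported[of "UNIV :: 'n set" D] by simp

definition bounded_exponents :: "nat \<Rightarrow> nat \<Rightarrow> ('n::finite \<Rightarrow>\<^sub>0 nat) set" where
  "bounded_exponents D m = {\<alpha>. total_degree \<alpha> \<le> D \<and> (\<forall>i. Poly_Mapping.lookup \<alpha> i \<le> m)}"

text \<open>A union bound: a vector outside \<open>bounded_exponents D m\<close> is \<open>Suc m\<close> times some unit vector plus
  a vector of degree at most \<open>D - Suc m\<close>.\<close>

lemma card_bounded_exponents_ge:
  shows "int (card (bounded_exponents D m :: ('n::finite \<Rightarrow>\<^sub>0 nat) set))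
    \<ge> int ((CARD('n) + D) choose CARD('n))
      - int CARD('n) * int ((CARD('n) + (D - Suc m)) choose CARD('n))"
proof -
  let ?E = "\<lambda>D. {\<alpha> :: 'n \<Rightarrow>\<^sub>0 nat. total_degree \<alpha> \<le> D}"
  let ?B = "bounded_exponents D m :: ('n \<Rightarrow>\<^sub>0 nat) set"
  let ?shift = "\<lambda>i \<alpha>. \<alpha> + Poly_Mapping.single (i::'n) (Suc m)"
  have "?E D \<subseteq> ?B \<union> (\<Union>i. ?shift i ` ?E (D - Suc m))"
  proof
    fix \<alpha> assume \<alpha>: "\<alpha> \<in> ?E D"
    show "\<alpha> \<in> ?B \<union> (\<Union>i. ?shift i ` ?E (D - Suc m))"
    proof (cases "\<alpha> \<in> ?B")
      case False
      then obtain i where i: "Suc m \<le> Poly_Mapping.lookup \<alpha> i"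
        using \<alpha> by (auto simp: bounded_exponents_def not_le Suc_le_eq)
      define \<beta> where "\<beta> = \<alpha> - Poly_Mapping.single i (Suc m)"
      have eq: "\<alpha> = ?shift i \<beta>" unfolding \<beta>_def by (rule shift_exponent[OF i])
      have "total_degree \<alpha> = total_degree \<beta> + Suc m"
        by (subst eq) (simp add: total_degree_add total_degree_single)
      then have "\<beta> \<in> ?E (D - Suc m)" using \<alpha> by simp
      then show ?thesis using eq by blast
    qed simp
  qed
  moreover have fin: "finite ?B"
    by (rule finite_subset[OF _ finite_exponents[of D]]) (auto simp: bounded_exponents_def)
  ultimately have "card (?E D) \<le> card (?B \<union> (\<Union>i. ?shift i ` ?E (D - Suc m)))"
    by (intro card_mono) (auto intro: finite_exponents)
  also have "\<dots> \<le> card ?B + card (\<Union>i. ?shift i ` ?E (D - Suc m))"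
    by (rule card_Un_le)
  also have "card (\<Union>i. ?shift i ` ?E (D - Suc m)) \<le> (\<Sum>i\<in>UNIV. card (?shift i ` ?E (D - Suc m)))"
    by (rule card_UN_le) simp
  also have "\<dots> \<le> (\<Sum>i\<in>(UNIV :: 'n set). card (?E (D - Suc m)))"
    by (intro sum_mono card_image_le finite_exponents)
  finally have "(CARD('n) + D) choose CARD('n)
      \<le> card ?B + CARD('n) * ((CARD('n) + (D - Suc m)) choose CARD('n))"
    by (simp add: card_exponents)
  then have "int ((CARD('n) + D) choose CARD('n))
      \<le> int (card ?B + CARD('n) * ((CARD('n) + (D - Suc m)) choose CARD('n)))"
    by (simp only: of_nat_le_iff)
  then show ?thesis by (simp only: of_nat_add of_nat_mult)
qed

section \<open>Monomials on a grid\<close>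

definition grid :: "real set \<Rightarrow> (real ^ 'n::finite) set" where
  "grid Z = {x. \<forall>i. x $ i \<in> Z}"

lemma vec_lambda_image_PiE_eq_grid:
  "vec_lambda ` (UNIV \<rightarrow>\<^sub>E Z) = (grid Z :: (real ^ 'n::finite) set)"
proof -
  have "x \<in> vec_lambda ` (UNIV \<rightarrow>\<^sub>E Z)" if "x \<in> grid Z" for x :: "real ^ 'n"
    using that by (intro image_eqI[of _ _ "vec_nth x"]) (auto simp: grid_def)
  then show ?thesis by (auto simp: grid_def)
qed

lemma finite_grid: "finite Z \<Longrightarrow> finite (grid Z :: (real ^ 'n::finite) set)"
  unfolding vec_lambda_image_PiE_eq_grid[symmetric] by (intro finite_imageI finite_PiE) auto

text \<open>Lagrange interpolation recovers the coefficients of a polynomial of degree at most \<open>m\<close> from its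
  values on \<open>Z\<close>, by formulas that are linear in these values. The weights \<open>w a\<close> extract the
  \<open>a\<close>-th coefficient: they are the \<open>a\<close>-th coefficients of the Lagrange basis polynomials.\<close>

lemma coefficient_weights:
  fixes Z :: "real set"
  assumes "finite Z" "card Z = Suc m"
  shows "\<exists>w. \<forall>a. \<forall>b\<le>m. (\<Sum>z\<in>Z. w a z * z ^ b) = (if a = b then 1 else 0)"
proof -
  define basis where
    "basis z = smult (inverse (\<Prod>y\<in>Z - {z}. z - y)) (\<Prod>y\<in>Z - {z}. [:- y, 1:])" for z
  have poly_basis: "poly (basis z) y = (if y = z then 1 else 0)" if "z \<in> Z" "y \<in> Z" for y z
    using that assms(1) by (auto simp: basis_def poly_prod)
  have degree_basis: "degree (basis z) \<le> m" if "z \<in> Z" for z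
  proof -
    have "degree (\<Prod>y\<in>Z - {z}. [:- y, 1:]) \<le> (\<Sum>y\<in>Z - {z}. degree [:- y, 1:])"
      by (rule order_trans[OF degree_prod_sum_le]) (use assms in auto)
    also have "\<dots> = m" using assms that by simp
    finally show ?thesis unfolding basis_def by (rule order_trans[OF degree_smult_le])
  qed
  have interpolation: "(\<Sum>z\<in>Z. smult (z ^ b) (basis z)) = monom 1 b" if "b \<le> m" for b
  proof (rule poly_eqI_degree)
    fix y assume y: "y \<in> Z"
    have "poly (\<Sum>z\<in>Z. smult (z ^ b) (basis z)) y = (\<Sum>z\<in>Z. if y = z then y ^ b else 0)"
      unfolding poly_sum by (intro sum.cong) (auto simp: poly_basis y)
    then show "poly (\<Sum>z\<in>Z. smult (z ^ b) (basis z)) y = poly (monom 1 b) y"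
      using assms y by (simp add: poly_monom)
  next
    have "degree (smult (z ^ b) (basis z)) \<le> m" if "z \<in> Z" for z
      using degree_smult_le degree_basis[OF that] order_trans by blast
    then have "degree (\<Sum>z\<in>Z. smult (z ^ b) (basis z)) \<le> m"
      by (intro degree_sum_le assms(1))
    then show "degree (\<Sum>z\<in>Z. smult (z ^ b) (basis z)) < card Z" using assms by simp
    show "degree (monom (1::real) b) < card Z" using assms that by (simp add: degree_monom_eq)
  qed
  have "(\<Sum>z\<in>Z. coeff (basis z) a * z ^ b) = (if a = b then 1 else 0)" if "b \<le> m" for a b
    using arg_cong[OF interpolation[OF that], of "\<lambda>p. coeff p a"]
    by (simp add: coeff_sum mult.commute eq_commute)
  then show ?thesis by (intro exI[of _ "\<lambda>a z. coeff (basis z) a"]) blast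
qed

text \<open>A product of univariate weights extracts the coefficient of a given monomial from the values on
  the grid, because the sum over the grid of a product of functions of single coordinates factors.\<close>

lemma polynomial_nonzero_on_grid:
  fixes u :: "('n::finite \<Rightarrow>\<^sub>0 nat) \<Rightarrow> real"
  assumes Z: "finite Z" "card Z = Suc m"
    and A: "finite A" "\<And>\<alpha> i. \<alpha> \<in> A \<Longrightarrow> Poly_Mapping.lookup \<alpha> i \<le> m"
    and \<alpha>: "\<alpha> \<in> A" "u \<alpha> \<noteq> 0"
  shows "\<exists>x\<in>grid Z. mpoly_eval (mpoly_of A u) x \<noteq> 0"
proof (rule ccontr)
  assume "\<not> ?thesis"
  then have vanish: "(\<Sum>\<beta>\<in>A. u \<beta> * monomial_eval \<beta> x) = 0" if "x \<in> grid Z" for x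
    using that by (auto simp: mpoly_eval_mpoly_of)
  obtain w where w: "\<And>a b. b \<le> m \<Longrightarrow> (\<Sum>z\<in>Z. w a z * z ^ b) = (if a = b then 1 else 0)"
    using coefficient_weights[OF Z] by blast
  let ?W = "\<lambda>x. \<Prod>i\<in>UNIV. w (Poly_Mapping.lookup \<alpha> i) (x i)"
  let ?G = "UNIV \<rightarrow>\<^sub>E Z :: ('n \<Rightarrow> real) set"
  have "(\<Sum>x\<in>?G. ?W x * monomial_eval \<beta> (vec_lambda x)) = (if \<beta> = \<alpha> then 1 else 0)"
    if "\<beta> \<in> A" for \<beta>
  proof -
    have "(\<Sum>x\<in>?G. ?W x * monomial_eval \<beta> (vec_lambda x))
        = (\<Sum>x\<in>?G. \<Prod>i\<in>UNIV. w (Poly_Mapping.lookup \<alpha> i) (x i) * x i ^ Poly_Mapping.lookup \<beta> i)"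
      by (simp add: monomial_eval_def prod.distrib)
    also have "\<dots> = (\<Prod>i\<in>UNIV. \<Sum>z\<in>Z. w (Poly_Mapping.lookup \<alpha> i) z * z ^ Poly_Mapping.lookup \<beta> i)"
      by (rule prod_sum_PiE[symmetric]) (use Z in auto)
    also have "\<dots> = (\<Prod>i\<in>UNIV. if Poly_Mapping.lookup \<alpha> i = Poly_Mapping.lookup \<beta> i then 1 else 0)"
      by (simp add: w A(2)[OF that])
    also have "\<dots> = (if \<beta> = \<alpha> then 1 else 0)"
    proof (cases "\<beta> = \<alpha>")
      case False
      then obtain i where "Poly_Mapping.lookup \<alpha> i \<noteq> Poly_Mapping.lookup \<beta> i"
        by (metis poly_mapping_eqI)
      then show ?thesis using False by (auto intro!: prod_zero)
    qed simp
    finally show ?thesis .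
  qed
  then have "u \<alpha> = (\<Sum>\<beta>\<in>A. u \<beta> * (\<Sum>x\<in>?G. ?W x * monomial_eval \<beta> (vec_lambda x)))"
    using \<alpha> A(1) by (simp add: if_distrib[of "(*) _"] cong: if_cong)
  also have "\<dots> = (\<Sum>\<beta>\<in>A. \<Sum>x\<in>?G. ?W x * (u \<beta> * monomial_eval \<beta> (vec_lambda x)))"
    by (simp add: sum_distrib_left mult.left_commute)
  also have "\<dots> = (\<Sum>x\<in>?G. ?W x * (\<Sum>\<beta>\<in>A. u \<beta> * monomial_eval \<beta> (vec_lambda x)))"
    by (subst sum.swap) (simp add: sum_distrib_left)
  also have "\<dots> = 0"
  proof (intro sum.neutral ballI)
    fix x assume "x \<in> ?G"
    then have "vec_lambda x \<in> grid Z" unfolding vec_lambda_image_PiE_eq_grid[symmetric] by blast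
    then show "?W x * (\<Sum>\<beta>\<in>A. u \<beta> * monomial_eval \<beta> (vec_lambda x)) = 0" by (simp add: vanish)
  qed
  finally show False using \<alpha> by simp
qed

section \<open>Atomic representations\<close>

lemma has_atomic_repI_finite:
  fixes X :: "(real ^ 'n::finite) set"
  assumes "finite I" "\<And>i. i \<in> I \<Longrightarrow> c i > 0 \<and> x i \<in> X"
    and "\<And>f. f \<in> mpolys_upto D \<Longrightarrow> L f = (\<Sum>i\<in>I. c i * mpoly_eval f (x i))"
  shows "has_atomic_rep X D L (card I)"
proof -
  obtain h where h: "bij_betw h {..<card I} I"
    using ex_bij_betw_nat_finite[OF assms(1)] by (auto simp: atLeast0LessThan)
  have "L f = (\<Sum>i<card I. c (h i) * mpoly_eval f (x (h i)))" if "f \<in> mpolys_upto D" for f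
    using assms(3)[OF that] sum.reindex_bij_betw[OF h, of "\<lambda>i. c i * mpoly_eval f (x i)"] by simp
  then show ?thesis
    unfolding has_atomic_rep_def using h assms(2)
    by (intro exI[of _ "\<lambda>i. c (h i)"] exI[of _ "\<lambda>i. x (h i)"]) (auto dest: bij_betwE)
qed

text \<open>The representing measure is a finite sum of weighted point masses, pushed forward from the
  discrete space \<open>G\<close> to the Borel sets of \<open>X\<close>.\<close>

lemma atomic_moment_functional:
  fixes G X :: "(real ^ 'n::finite) set"
  assumes "finite G" "G \<subseteq> X" and c: "\<And>x. x \<in> G \<Longrightarrow> c x > 0"
  shows "moment_functional X D (\<lambda>f. \<Sum>x\<in>G. c x * mpoly_eval f x)"
    and "\<exists>k. has_atomic_rep X D (\<lambda>f. \<Sum>x\<in>G. c x * mpoly_eval f x) k"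
proof -
  define L where "L = (\<lambda>f. \<Sum>x\<in>G. c x * mpoly_eval f x)"
  define \<nu> where "\<nu> = point_measure G (\<lambda>x. ennreal (c x))"
  define \<mu> where "\<mu> = distr \<nu> (restrict_space borel X) (\<lambda>x. x)"
  have meas: "(\<lambda>x. x) \<in> \<nu> \<rightarrow>\<^sub>M restrict_space borel X"
    using assms(2) by (auto simp: \<nu>_def space_restrict_space)
  have fmeas: "mpoly_eval f \<in> borel_measurable (restrict_space borel X)" for f :: "'n mpoly"
    by (intro measurable_restrict_space1 borel_measurable_continuous_onI continuous_on_mpoly_eval)
  have "integrable \<mu> (mpoly_eval f)" for f
    unfolding \<mu>_def using assms(1)
    by (subst integrable_distr_eq[OF meas fmeas])
       (auto simp: \<nu>_def intro!: integrable_point_measure_finite)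
  moreover have "L f = (\<integral>x. mpoly_eval f x \<partial>\<mu>)" for f
    unfolding \<mu>_def L_def using assms(1) c
    by (subst integral_distr[OF meas fmeas])
       (simp add: \<nu>_def lebesgue_integral_point_measure_finite less_imp_le)
  moreover have "linear_functional_upto D L"
    by (simp add: linear_functional_upto_def L_def mpoly_eval_add mpoly_eval_scale
        distrib_left sum.distrib sum_distrib_left mult.left_commute)
  moreover have "sets \<mu> = sets (restrict_space borel X)" by (simp add: \<mu>_def)
  ultimately have "moment_functional X D L"
    unfolding moment_functional_def by blast
  then show "moment_functional X D (\<lambda>f. \<Sum>x\<in>G. c x * mpoly_eval f x)" unfolding L_def .
  have "has_atomic_rep X D L (card G)"
    by (rule has_atomic_repI_finite[where c = c and x = "\<lambda>x. x"])
       (use assms in \<open>auto simp: L_def\<close>)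
  then show "\<exists>k. has_atomic_rep X D (\<lambda>f. \<Sum>x\<in>G. c x * mpoly_eval f x) k"
    unfolding L_def by blast
qed

text \<open>Caratheodory's reduction. More atoms than monomials force a linear relation among the point
  evaluations. Subtracting the right multiple of this relation makes one weight vanish while no
  weight becomes negative.\<close>

lemma atomic_rep_reduce:
  fixes X :: "(real ^ 'n::finite) set"
  assumes rep: "has_atomic_rep X D L k" and k: "k > (CARD('n) + D) choose CARD('n)"
  shows "\<exists>j<k. has_atomic_rep X D L j"
proof -
  let ?E = "{\<alpha> :: 'n \<Rightarrow>\<^sub>0 nat. total_degree \<alpha> \<le> D}"
  obtain c x where cx: "\<And>i. i < k \<Longrightarrow> c i > 0 \<and> x i \<in> X"
    and L: "\<And>f. f \<in> mpolys_upto D \<Longrightarrow> L f = (\<Sum>i<k. c i * mpoly_eval f (x i))"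
    using rep unfolding has_atomic_rep_def by blast
  obtain v where v: "\<exists>i<k. v i \<noteq> 0" "\<And>\<alpha>. \<alpha> \<in> ?E \<Longrightarrow> (\<Sum>i<k. v i * monomial_eval \<alpha> (x i)) = 0"
    using underdetermined_system_nontrivial_solution
        [of ?E "{..<k}" "\<lambda>i \<alpha>. monomial_eval \<alpha> (x i)"] k
    by (auto simp: finite_exponents card_exponents)
  (* The step size below needs a positive coefficient in the relation; s flips signs if necessary. *)
  obtain s :: real where s: "\<exists>i<k. s * v i > 0"
  proof -
    obtain i where "i < k" "v i \<noteq> 0" using v(1) by blast
    then have "v i * v i > 0" by (metis not_real_square_gt_zero)
    then show ?thesis using \<open>i < k\<close> that by blast
  qed
  define a where "a i = s * v i" for i
  have a0: "(\<Sum>i<k. a i * mpoly_eval f (x i)) = 0" if "f \<in> mpolys_upto D" for f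
  proof -
    have "mpoly_eval f y = (\<Sum>\<alpha>\<in>?E. Poly_Mapping.lookup f \<alpha> * monomial_eval \<alpha> y)" for y
      using that by (intro mpoly_eval_superset finite_exponents) (simp add: mpolys_upto_iff)
    then have "(\<Sum>i<k. a i * mpoly_eval f (x i))
       = (\<Sum>i<k. \<Sum>\<alpha>\<in>?E. s * Poly_Mapping.lookup f \<alpha> * (v i * monomial_eval \<alpha> (x i)))"
      by (simp add: a_def sum_distrib_left mult_ac)
    also have "\<dots> = (\<Sum>\<alpha>\<in>?E. s * Poly_Mapping.lookup f \<alpha> * (\<Sum>i<k. v i * monomial_eval \<alpha> (x i)))"
      by (subst sum.swap) (simp add: sum_distrib_left)
    finally show ?thesis using v(2) by simp
  qed
  define P where "P = {i. i < k \<and> a i > 0}"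
  have P: "finite P" "P \<noteq> {}" using s by (auto simp: P_def a_def)
  (* The largest multiple of a that can be subtracted from c without a negative weight. *)
  define t where "t = Min ((\<lambda>i. c i / a i) ` P)"
  have "t \<in> (\<lambda>i. c i / a i) ` P" unfolding t_def using P by (intro Min_in) auto
  then obtain i0 where i0: "i0 \<in> P" "t = c i0 / a i0" by blast
  have t_le: "t \<le> c i / a i" if "i \<in> P" for i
    unfolding t_def using P that by (intro Min_le) auto
  have "t > 0" using i0 cx by (auto simp: P_def)
  define e where "e i = c i - t * a i" for i
  have e_nonneg: "e i \<ge> 0" if "i < k" for i
  proof (cases "a i > 0")
    case True
    then show ?thesis using t_le[of i] that by (simp add: P_def e_def pos_le_divide_eq)
  next
    case False
    then have "t * a i \<le> 0" using \<open>t > 0\<close> by (simp add: mult_le_0_iff)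
    then show ?thesis using cx[OF that] by (simp add: e_def)
  qed
  define I where "I = {i. i < k \<and> e i \<noteq> 0}"
  have "e i0 = 0" using i0 by (simp add: e_def P_def)
  then have "I \<subseteq> {..<k} - {i0}" by (auto simp: I_def)
  then have "card I \<le> card ({..<k} - {i0})" by (intro card_mono) auto
  also have "\<dots> < k" using i0 by (simp add: P_def)
  finally have "card I < k" .
  moreover have "has_atomic_rep X D L (card I)"
  proof (rule has_atomic_repI_finite)
    fix f :: "'n mpoly" assume f: "f \<in> mpolys_upto D"
    have "L f = (\<Sum>i<k. c i * mpoly_eval f (x i)) - t * (\<Sum>i<k. a i * mpoly_eval f (x i))"
      using L[OF f] a0[OF f] by simp
    also have "\<dots> = (\<Sum>i<k. e i * mpoly_eval f (x i))"
      by (simp add: e_def algebra_simps sum_subtractf sum_distrib_left)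
    also have "\<dots> = (\<Sum>i\<in>I. e i * mpoly_eval f (x i))"
      by (intro sum.mono_neutral_right) (auto simp: I_def)
    finally show "L f = (\<Sum>i\<in>I. e i * mpoly_eval f (x i))" .
  qed (use e_nonneg cx in \<open>auto simp: I_def order_less_le\<close>)
  ultimately show ?thesis by blast
qed

lemma caratheodory_number_le:
  fixes X :: "(real ^ 'n::finite) set"
  assumes "has_atomic_rep X D L k"
  shows "caratheodory_number X D L \<le> (CARD('n) + D) choose CARD('n)"
proof (rule ccontr)
  assume "\<not> ?thesis"
  moreover have "has_atomic_rep X D L (caratheodory_number X D L)"
    unfolding caratheodory_number_def using assms by (rule LeastI)
  ultimately obtain j where "j < caratheodory_number X D L" "has_atomic_rep X D L j"
    using atomic_rep_reduce by (metis not_le)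
  then show False unfolding caratheodory_number_def using not_less_Least by blast
qed

text \<open>A functional with an atomic representation has a number in the bounded range. For all others
  the predicate under the \<open>LEAST\<close> operator is constantly false, so together they contribute the single
  value \<open>LEAST k. False\<close>. Finiteness therefore holds for every family of functionals and every \<open>X\<close>.\<close>

lemma finite_caratheodory_numbers:
  fixes X :: "(real ^ 'n::finite) set"
  shows "finite {caratheodory_number X D L |L. Q L}"
proof (rule finite_subset)
  show "{caratheodory_number X D L |L. Q L}
        \<subseteq> {..(CARD('n) + D) choose CARD('n)} \<union> {LEAST k. False}"
  proof
    fix r assume "r \<in> {caratheodory_number X D L |L. Q L}"
    then obtain L where L: "r = caratheodory_number X D L" by blast
    show "r \<in> {..(CARD('n) + D) choose CARD('n)} \<union> {LEAST k. False}"
    proof (cases "\<exists>k. has_atomic_rep X D L k")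
      case True
      then show ?thesis using L caratheodory_number_le by blast
    next
      case False
      then show ?thesis using L by (simp add: caratheodory_number_def)
    qed
  qed
qed auto

section \<open>Functionals supported on a grid in the cube\<close>

text \<open>Number the points of \<open>G\<close> by \<open>h\<close> and take the weights \<open>t ^ h x\<close>. Each sum is then a nonzero
  polynomial in \<open>t\<close>, and some \<open>t > 0\<close> avoids the finitely many roots of finitely many such polynomials.\<close>

lemma generic_positive_weights:
  fixes G :: "'a set" and F :: "('a \<Rightarrow> real) set"
  assumes "finite G" "finite F" "\<And>f. f \<in> F \<Longrightarrow> \<exists>x\<in>G. f x \<noteq> 0"
  shows "\<exists>c. (\<forall>x\<in>G. c x > 0) \<and> (\<forall>f\<in>F. (\<Sum>x\<in>G. c x * f x) \<noteq> 0)"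
proof -
  obtain h :: "'a \<Rightarrow> nat" where h: "inj_on h G"
    using finite_imp_inj_to_nat_seg[OF assms(1)] by blast
  define P where "P f = (\<Sum>x\<in>G. monom (f x) (h x))" for f :: "'a \<Rightarrow> real"
  have "P f \<noteq> 0" if f: "f \<in> F" for f
  proof -
    obtain x where x: "x \<in> G" "f x \<noteq> 0" using assms(3)[OF f] by blast
    have "coeff (P f) (h x) = (\<Sum>y\<in>G. if y = x then f y else 0)"
      unfolding P_def coeff_sum using h x by (intro sum.cong) (auto dest: inj_onD)
    then have "coeff (P f) (h x) \<noteq> 0" using x assms(1) by simp
    then show ?thesis by auto
  qed
  then have "finite (\<Union>f\<in>F. {t. poly (P f) t = 0})"
    using assms(2) by (auto intro: poly_roots_finite)
  then have "\<not> {0<..} \<subseteq> (\<Union>f\<in>F. {t. poly (P f) t = 0})"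
    using infinite_Ioi finite_subset by blast
  then obtain t where t: "t > 0" "\<And>f. f \<in> F \<Longrightarrow> poly (P f) t \<noteq> 0" by auto
  then have "(\<Sum>x\<in>G. t ^ h x * f x) \<noteq> 0" if "f \<in> F" for f
    using that by (force simp: P_def poly_sum poly_monom mult.commute)
  then show ?thesis using t by (intro exI[of _ "\<lambda>x. t ^ h x"]) auto
qed

text \<open>The polynomial \<open>q(x\<^sub>1) + \<dots> + q(x\<^sub>n)\<close>. The exponent vectors in the \<open>i\<close>-th summand are multiples
  of a unit vector, so their total degree is the exponent of \<open>x\<^sub>i\<close>.\<close>

definition sum_over_coordinates :: "real poly \<Rightarrow> 'n::finite mpoly" where
  "sum_over_coordinates q =
     (\<Sum>i\<in>UNIV. mpoly_of (Poly_Mapping.single i ` {..degree q}) (\<lambda>\<alpha>. coeff q (total_degree \<alpha>)))"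

lemma mpoly_eval_sum_over_coordinates:
  fixes x :: "real ^ 'n::finite"
  shows "mpoly_eval (sum_over_coordinates q) x = (\<Sum>i\<in>UNIV. poly q (x $ i))"
proof -
  have "monomial_eval (Poly_Mapping.single i k) x = (x $ i) ^ k" for i k
  proof -
    have "monomial_eval (Poly_Mapping.single i k) x = (\<Prod>j\<in>UNIV. if j = i then (x $ i) ^ k else 1)"
      unfolding monomial_eval_def by (intro prod.cong) (auto simp: lookup_single when_def)
    then show ?thesis by simp
  qed
  moreover have "inj_on (Poly_Mapping.single i) S" for i :: 'n and S :: "nat set"
    by (metis inj_onI lookup_single_eq)
  ultimately show ?thesis
    by (simp add: sum_over_coordinates_def mpoly_eval_sum mpoly_eval_mpoly_of sum.reindex
        total_degree_single poly_altdef)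
qed

lemma sum_over_coordinates_in_mpolys_upto:
  assumes "degree q \<le> D"
  shows "sum_over_coordinates q \<in> mpolys_upto D"
proof -
  have "Poly_Mapping.keys (mpoly_of (Poly_Mapping.single i ` {..degree q}) u)
      \<subseteq> {\<alpha>. total_degree \<alpha> \<le> D}" for i :: 'a and u
    using assms unfolding mpolys_upto_iff[symmetric]
    by (intro mpoly_of_in_mpolys_upto) (auto simp: total_degree_single)
  then show ?thesis
    unfolding mpolys_upto_iff sum_over_coordinates_def
    by (intro order_trans[OF keys_sum]) blast
qed

text \<open>A nonnegative polynomial annihilated by a functional confines the atoms of every representation
  of it, since a vanishing sum of nonnegative terms has only vanishing terms.\<close>

lemma atoms_in_zero_set:
  fixes k :: nat
  assumes c: "\<And>i. i < k \<Longrightarrow> c i > 0 \<and> x i \<in> X"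
    and zero: "(\<Sum>i<k. c i * mpoly_eval p (x i)) = 0"
    and p: "\<And>y. y \<in> X \<Longrightarrow> mpoly_eval p y \<ge> 0"
    and "i < k"
  shows "mpoly_eval p (x i) = 0"
proof -
  have "\<forall>i\<in>{..<k}. c i * mpoly_eval p (x i) = 0"
    using sum_nonneg_eq_0_iff[of "{..<k}" "\<lambda>i. c i * mpoly_eval p (x i)"] zero c p
    by (auto simp: less_imp_le)
  then have "c i * mpoly_eval p (x i) = 0" using \<open>i < k\<close> by blast
  then show ?thesis using c[OF \<open>i < k\<close>] by auto
qed

text \<open>The core of the argument, for any finite node set \<open>Z\<close> that is the exact zero set of a nonnegative
  univariate polynomial \<open>q\<close>: the functional is a generic positive combination of the evaluations at
  the points of \<open>Z\<^sup>n\<close>.\<close>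

lemma max_caratheodory_number_unit_cube_ge:
  fixes q :: "real poly"
  assumes Z: "finite Z" "card Z = Suc m" "Z \<subseteq> {0..1}"
    and q: "degree q \<le> D" "\<And>t. t \<in> {0..1} \<Longrightarrow> poly q t \<ge> 0"
      "\<And>t. t \<in> {0..1} \<Longrightarrow> poly q t = 0 \<longleftrightarrow> t \<in> Z"
  shows "max_caratheodory_number (unit_cube :: (real ^ 'n::finite) set) D
         \<ge> card (bounded_exponents D m :: ('n \<Rightarrow>\<^sub>0 nat) set)"
proof -
  let ?A = "bounded_exponents D m :: ('n \<Rightarrow>\<^sub>0 nat) set"
  let ?X = "unit_cube :: (real ^ 'n) set"
  define G :: "(real ^ 'n) set" where "G = grid Z"
  define p :: "'n mpoly" where "p = sum_over_coordinates q"
  have p_in: "p \<in> mpolys_upto D"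
    unfolding p_def by (rule sum_over_coordinates_in_mpolys_upto[OF q(1)])
  have p_nonneg: "mpoly_eval p y \<ge> 0" if "y \<in> ?X" for y
    using that q(2) by (auto simp: p_def mpoly_eval_sum_over_coordinates unit_cube_def intro!: sum_nonneg)
  have p_zero: "mpoly_eval p y = 0 \<longleftrightarrow> y \<in> G" if "y \<in> ?X" for y
  proof -
    have y: "y $ i \<in> {0..1}" for i using that by (simp add: unit_cube_def)
    have "mpoly_eval p y = 0 \<longleftrightarrow> (\<forall>i\<in>UNIV. poly q (y $ i) = 0)"
      unfolding p_def mpoly_eval_sum_over_coordinates
      by (rule sum_nonneg_eq_0_iff) (use q(2)[OF y] in auto)
    also have "\<dots> \<longleftrightarrow> y \<in> G" using q(3)[OF y] by (simp add: G_def grid_def)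
    finally show ?thesis .
  qed
  have fin_G: "finite G" unfolding G_def by (rule finite_grid[OF Z(1)])
  have G_sub: "G \<subseteq> ?X" using Z(3) by (auto simp: G_def grid_def unit_cube_def)
  have fin_A: "finite ?A"
    by (rule finite_subset[OF _ finite_exponents[of D]]) (auto simp: bounded_exponents_def)
  let ?S = "{S. S \<subseteq> G \<and> card S < card ?A}"
  (* S ranges over the possible sets of atoms of a representation that is too short; the polynomial
     f will witness that none of them carries the functional. *)
  have "\<exists>f\<in>mpolys_upto D. (\<forall>x\<in>S. mpoly_eval f x = 0) \<and> (\<exists>x\<in>G. mpoly_eval f x \<noteq> 0)"
    if S: "S \<in> ?S" for S
  proof -
    have "finite S" using S fin_G finite_subset by blast
    then obtain u where u: "\<exists>\<alpha>\<in>?A. u \<alpha> \<noteq> 0" "\<forall>x\<in>S. (\<Sum>\<alpha>\<in>?A. u \<alpha> * monomial_eval \<alpha> x) = 0"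
      using underdetermined_system_nontrivial_solution[of S ?A monomial_eval] S fin_A by blast
    have "\<exists>x\<in>G. mpoly_eval (mpoly_of ?A u) x \<noteq> 0"
      using u(1) polynomial_nonzero_on_grid[OF Z(1,2) fin_A, of _ u]
      unfolding G_def by (auto simp: bounded_exponents_def)
    moreover have "mpoly_of ?A u \<in> mpolys_upto D"
      by (intro mpoly_of_in_mpolys_upto) (auto simp: bounded_exponents_def)
    ultimately show ?thesis using u(2) by (intro bexI[of _ "mpoly_of ?A u"]) (auto simp: mpoly_eval_mpoly_of)
  qed
  then have "\<forall>S\<in>?S. \<exists>f. f \<in> mpolys_upto D \<and> (\<forall>x\<in>S. mpoly_eval f x = 0)
      \<and> (\<exists>x\<in>G. mpoly_eval f x \<noteq> 0)"
    by blast
  from bchoice[OF this] obtain g where g: "\<And>S. S \<in> ?S \<Longrightarrow> g S \<in> mpolys_upto D"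
      "\<And>S x. S \<in> ?S \<Longrightarrow> x \<in> S \<Longrightarrow> mpoly_eval (g S) x = 0"
      "\<And>S. S \<in> ?S \<Longrightarrow> \<exists>x\<in>G. mpoly_eval (g S) x \<noteq> 0"
    by blast
  have "\<exists>c. (\<forall>x\<in>G. c x > 0) \<and>
      (\<forall>f\<in>(\<lambda>S. mpoly_eval (g S)) ` ?S. (\<Sum>x\<in>G. c x * f x) \<noteq> 0)"
    by (rule generic_positive_weights[OF fin_G]) (use fin_G g(3) in auto)
  then obtain c where c: "\<And>x. x \<in> G \<Longrightarrow> c x > 0"
      "\<And>S. S \<in> ?S \<Longrightarrow> (\<Sum>x\<in>G. c x * mpoly_eval (g S) x) \<noteq> 0"
    by blast
  define L where "L = (\<lambda>f. \<Sum>x\<in>G. c x * mpoly_eval f x)"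
  have L_moment: "moment_functional ?X D L" "\<exists>k. has_atomic_rep ?X D L k"
    unfolding L_def by (rule atomic_moment_functional[OF fin_G G_sub]; simp add: c(1))+
  have k_ge: "card ?A \<le> k" if rep: "has_atomic_rep ?X D L k" for k
  proof (rule ccontr)
    assume "\<not> card ?A \<le> k"
    obtain b x where bx: "\<And>i. i < k \<Longrightarrow> b i > 0 \<and> x i \<in> ?X"
      and L_eq: "\<And>f. f \<in> mpolys_upto D \<Longrightarrow> L f = (\<Sum>i<k. b i * mpoly_eval f (x i))"
      using rep unfolding has_atomic_rep_def by blast
    have "L p = 0" unfolding L_def using p_zero G_sub by (intro sum.neutral) auto
    then have "mpoly_eval p (x i) = 0" if "i < k" for i
      using atoms_in_zero_set[of k b x ?X p i] bx L_eq[OF p_in] p_nonneg that by auto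
    then have "x ` {..<k} \<subseteq> G" using p_zero bx by auto
    moreover have "card (x ` {..<k}) < card ?A"
      using \<open>\<not> card ?A \<le> k\<close> card_image_le[of "{..<k}" x] by simp
    ultimately have S: "x ` {..<k} \<in> ?S" by simp
    have "L (g (x ` {..<k})) = 0"
      using L_eq[OF g(1)[OF S]] g(2)[OF S] by simp
    then show False using c(2)[OF S] by (simp add: L_def)
  qed
  have "has_atomic_rep ?X D L (caratheodory_number ?X D L)"
    unfolding caratheodory_number_def using L_moment(2) by (rule LeastI_ex)
  then have "card ?A \<le> caratheodory_number ?X D L" by (rule k_ge)
  also have "\<dots> \<le> max_caratheodory_number ?X D"
    unfolding max_caratheodory_number_def
    by (intro Max_ge finite_caratheodory_numbers) (use L_moment(1) in blast)
  finally show ?thesis .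
qed

section \<open>Nonnegative polynomials with prescribed zeros\<close>

definition equidistant_nodes :: "nat \<Rightarrow> real set" where
  "equidistant_nodes d = (\<lambda>j. real j / real d) ` {..d}"

lemma equidistant_nodes:
  assumes "d \<ge> 1"
  shows "finite (equidistant_nodes d)" "card (equidistant_nodes d) = Suc d"
    "equidistant_nodes d \<subseteq> {0..1}"
proof -
  have "inj_on (\<lambda>j. real j / real d) {..d}" using assms by (auto intro: inj_onI)
  then show "card (equidistant_nodes d) = Suc d" by (simp add: equidistant_nodes_def card_image)
qed (use assms in \<open>auto simp: equidistant_nodes_def\<close>)

lemma degree_prod_squares_le:
  "finite J \<Longrightarrow> degree (\<Prod>j\<in>J. [:- f j, 1:] ^ 2 :: real poly) \<le> 2 * card J"
  using degree_prod_sum_le[of J "\<lambda>j. [:- f j, 1:] ^ 2 :: real poly"]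
  by (simp add: degree_power_eq)

text \<open>Both endpoints are simple zeros, which costs degree 2; the \<open>d - 1\<close> interior nodes are double
  zeros, which costs degree \<open>2d - 2\<close>.\<close>

lemma even_node_polynomial:
  fixes d :: nat
  assumes "d \<ge> 1"
  defines "q \<equiv> [:0, 1:] * [:1, -1:] * (\<Prod>j=1..<d. [:- (real j / real d), 1:] ^ 2)"
  shows "degree q \<le> 2 * d" "\<And>t. t \<in> {0..1} \<Longrightarrow> poly q t \<ge> 0"
    "poly q t = 0 \<longleftrightarrow> t \<in> equidistant_nodes d"
proof -
  have "degree q \<le> 1 + 1 + 2 * card {1..<d}"
    unfolding q_def
    by (intro order_trans[OF degree_mult_le] add_mono degree_prod_squares_le) auto
  then show "degree q \<le> 2 * d" using assms(1) by simp
  have poly: "poly q t = t * (1 - t) * (\<Prod>j=1..<d. (t - real j / real d) ^ 2)" for t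
    by (simp add: q_def poly_prod left_diff_distrib)
  show "poly q t \<ge> 0" if "t \<in> {0..1}" for t
    unfolding poly using that by (intro mult_nonneg_nonneg prod_nonneg) auto
  have "{..d} = insert 0 (insert d {1..<d})" using assms(1) by auto
  then have "equidistant_nodes d = insert 0 (insert 1 ((\<lambda>j. real j / real d) ` {1..<d}))"
    using assms(1) by (simp add: equidistant_nodes_def)
  then show "poly q t = 0 \<longleftrightarrow> t \<in> equidistant_nodes d"
    unfolding poly by auto
qed

text \<open>An odd degree leaves room for a simple zero at the endpoint 0 only; the other endpoint is
  a double zero, like the interior nodes.\<close>

lemma odd_node_polynomial:
  fixes d :: nat
  defines "q \<equiv> [:0, 1:] * (\<Prod>j=1..d. [:- (real j / real d), 1:] ^ 2)"
  shows "degree q \<le> 2 * d + 1" "\<And>t. t \<in> {0..1} \<Longrightarrow> poly q t \<ge> 0"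
    "poly q t = 0 \<longleftrightarrow> t \<in> equidistant_nodes d"
proof -
  have "degree q \<le> 1 + 2 * card {1..d}"
    unfolding q_def
    by (intro order_trans[OF degree_mult_le] add_mono degree_prod_squares_le) auto
  then show "degree q \<le> 2 * d + 1" by simp
  have poly: "poly q t = t * (\<Prod>j=1..d. (t - real j / real d) ^ 2)" for t
    by (simp add: q_def poly_prod)
  show "poly q t \<ge> 0" if "t \<in> {0..1}" for t
    unfolding poly using that by (intro mult_nonneg_nonneg prod_nonneg) auto
  have "{..d} = insert 0 {1..d}" by auto
  then have "equidistant_nodes d = insert 0 ((\<lambda>j. real j / real d) ` {1..d})"
    by (simp add: equidistant_nodes_def)
  then show "poly q t = 0 \<longleftrightarrow> t \<in> equidistant_nodes d"
    unfolding poly by auto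
qed

section \<open>The lower bounds for even and odd degree\<close>

theorem theorem5p4:
  fixes d :: nat
  assumes "d \<ge> 1"
  shows "int (max_caratheodory_number (unit_cube :: (real ^ 'n::finite) set) (2 * d))
           \<ge> int ((CARD('n) + 2 * d) choose CARD('n))
             - int CARD('n) * int ((CARD('n) + d - 1) choose CARD('n))
       \<and> int (max_caratheodory_number (unit_cube :: (real ^ 'n::finite) set) (2 * d + 1))
           \<ge> int ((CARD('n) + 2 * d + 1) choose CARD('n))
             - int CARD('n) * int ((CARD('n) + d) choose CARD('n))"
proof
  note nodes = equidistant_nodes[OF assms]
  have eqs: "CARD('n) + (2 * d - Suc d) = CARD('n) + d - 1"
    "CARD('n) + (2 * d + 1 - Suc d) = CARD('n) + d"
    using assms by auto
  have "int ((CARD('n) + 2 * d) choose CARD('n))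
             - int CARD('n) * int ((CARD('n) + d - 1) choose CARD('n))
      \<le> int (card (bounded_exponents (2 * d) d :: ('n \<Rightarrow>\<^sub>0 nat) set))"
    using card_bounded_exponents_ge[where 'n = 'n, of "2 * d" d] by (simp only: eqs)
  also have "\<dots> \<le> int (max_caratheodory_number (unit_cube :: (real ^ 'n) set) (2 * d))"
    using max_caratheodory_number_unit_cube_ge[OF nodes even_node_polynomial[OF assms]] by simp
  finally show "int (max_caratheodory_number (unit_cube :: (real ^ 'n) set) (2 * d))
           \<ge> int ((CARD('n) + 2 * d) choose CARD('n))
             - int CARD('n) * int ((CARD('n) + d - 1) choose CARD('n))" .
  have "int ((CARD('n) + 2 * d + 1) choose CARD('n))
             - int CARD('n) * int ((CARD('n) + d) choose CARD('n))
      \<le> int (card (bounded_exponents (2 * d + 1) d :: ('n \<Rightarrow>\<^sub>0 nat) set))"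
    using card_bounded_exponents_ge[where 'n = 'n, of "2 * d + 1" d]
    by (simp only: eqs add.assoc)
  also have "\<dots> \<le> int (max_caratheodory_number (unit_cube :: (real ^ 'n) set) (2 * d + 1))"
    using max_caratheodory_number_unit_cube_ge[OF nodes odd_node_polynomial] by simp
  finally show "int (max_caratheodory_number (unit_cube :: (real ^ 'n) set) (2 * d + 1))
           \<ge> int ((CARD('n) + 2 * d + 1) choose CARD('n))
             - int CARD('n) * int ((CARD('n) + d) choose CARD('n))" .
qed

end
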